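(* Suppose strong duality holds for $\mathcal{UC}^{\mathrm{CPP}}$, i.e. $\mathcal{UC}^{\mathrm{CPP}}$ and its dual $\mathcal{UC}^{\mathrm{COP}}$ have equal optimal values (and the dual optimum is attained, so that the copositive duality pricing (CDP) mechanism is defined). Then the CDP mechanism balances the revenue and the aggregate cost of the generators: $$\sum_{g\in\mathcal{G}}\sum_{t\in\mathcal{T}}\pi^{\mathrm G}_{gt}=\sum_{g\in\mathcal{G}}\sum_{t\in\mathcal{T}}\left(c^p_g p^*_{gt}+c^u_g u^*_{gt}\right).$$ It also balances the revenue and the payment of the system operator: $$\sum_{t\in\mathcal{T}}\pi^{\mathrm L}_t=\sum_{g\in\mathcal{G}}\sum_{t\in\mathcal{T}}\pi^{\mathrm G}_{gt}.$$
   Context: **Cones.** Let $\mathcal{S}_n$ be the real symmetric $n\times n$ matrices, $\mathcal{C}_n=\{X\in\mathcal{S}_n: y^\top Xy\ge 0\ \forall y\in\mathbb{R}^n_+\}$ the copositive cone and $\mathcal{C}_n^*=\{XX^\top : X\in\mathbb{R}^{n\times r}_+ \text{ for some } r\}$ the completely positive cone. **Unit commitment problem $\mathcal{UC}$.** $\mathcal{G}$ is a finite set of generators, $\mathcal{T}$ a finite set of time periods; $c^p_g,c^u_g,d_t$ are real data (production cost, startup cost, load). The decision vector $\mathbf{x}\in\mathbb{R}^n_+$ has components $u_{gt}$ (startup), $z_{gt}$ (on/off), $p_{gt}$ (production) and slack variables $\psi_{jgt}$ ($g\in\mathcal{G}$, $t\in\mathcal{T}$, $j=1,\dots,m$). $\mathcal{UC}$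 is $$\min \sum_{g,t}(c^p_gp_{gt}+c^u_gu_{gt})\ \text{ s.t. }\ \sum_{g}p_{gt}=d_t\ \forall t;\quad \mathbf{a}_{jgt}^\top\mathbf{x}=b_{jgt}\ \forall j,g,t;\quad z_{gt}\in\{0,1\}\ \forall g,t;\quad \mathbf{x}\ge 0 .$$ The constraints $\mathbf{a}_{jgt}^\top \mathbf{x}=b_{jgt}$ are operational constraints of the individual generator $g$: $\mathbf{a}_{jgt}$ is supported on the components of $\mathbf{x}$ belonging to generator $g$. The linear constraints together with $\mathbf{x}\ge0$ imply $0\le z_{gt}\le1$. Let $\mathbf{c}\in\mathbb{R}^n$ be the cost vector, so the objective is $\mathbf{c}^\top\mathbf{x}$, and let $\mathbf{h}_t\in\mathbb{R}^n$ satisfy $\mathbf{h}_t^\top\mathbf{x}=\sum_gp_{gt}$. **Completely positive reformulation $\mathcal{UC}^{\mathrm{CPP}}$.** Variables $\mathbf{x}\in\mathbb{R}^n$, $X\in\mathcal{S}_n$. $X^{vw}_{k,q}$ denotes the entry of $X$ in the row of variable $v_k$ and column of variable $w_q$ (e.g. $X^{pp}_{gt,g't}$); $Z_{gt}=X^{zz}_{gt,gt}$. The problem is $$\min\ \mathbf{c}^\top\mathbf{x}\ \text{ s.t. }\ \mathbf{h}_t^\top\mathbf{x}=d_t,\ \ \mathbf{a}_{jgt}^\top\mathbf{x}=b_{jgt},\ \ \mathrm{Tr}(\mathbf{h}_t\mathbf{h}_t^\top X)=d_t^2,\ \ \mathrm{Tr}(\mathbf{a}_{jgt}\mathbf{a}_{jgt}^\top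 X)=b_{jgt}^2,\ \ z_{gt}=Z_{gt},\ \ Y=\begin{bmatrix}1&\mathbf{x}^\top\\ \mathbf{x}&X\end{bmatrix}\in\mathcal{C}^*_{n+1},$$ for all $j,g,t$. The constraints have dual variables $\lambda_t,\phi_{jgt},\Lambda_t,\Phi_{jgt},\delta_{gt},\Omega$ respectively. By a theorem of Burer (2009), $\mathcal{UC}$ and $\mathcal{UC}^{\mathrm{CPP}}$ have the same optimal value. **Dual $\mathcal{UC}^{\mathrm{COP}}$.** For $\mathbf{a}\in\mathbb{R}^n$ put $A(\mathbf{a})=\begin{bmatrix}0&\frac12\mathbf{a}^\top\\ \frac12\mathbf{a}&0\end{bmatrix}$, $\tilde A(\mathbf{a})=\begin{bmatrix}0\\ \mathbf{a}\end{bmatrix}\begin{bmatrix}0&\mathbf{a}^\top\end{bmatrix}$, both in $\mathcal{S}_{n+1}$. If $k$ is the index of $z_{gt}$ in $\mathbf{x}$, let $B_{gt}\in\mathcal{S}_{n+1}$ have entries $\frac12$ at positions $(k+1,1)$ and $(1,k+1)$, $-1$ at $(k+1,k+1)$, and $0$ elsewhere. Then $\mathcal{UC}^{\mathrm{COP}}$ is $$\max\ \sum_{t}\Big(d_t\lambda_t+d_t^2\Lambda_t+\sum_{j,g}(b_{jgt}\phi_{jgt}+b_{jgt}^2\Phi_{jgt})\Big)$$ $$\text{s.t. } A(\mathbf{c})-\sum_t\lambda_tA(\mathbf{h}_t)-\sum_{j,g,t}\phi_{jgt}A(\mathbf{a}_{jgt})-\sum_t\Lambda_t\tilde A(\mathbf{h}_t)-\sum_{j,g,t}\Phi_{jgt}\tilde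 A(\mathbf{a}_{jgt})-\sum_{g,t}\delta_{gt}B_{gt}-\Omega=0,\quad \Omega\in\mathcal{C}_{n+1},$$ with all other dual variables free real. **CDP mechanism.** Let $\mathbf{x}^*$ (with components $p^*_{gt},u^*_{gt},\dots$) be an optimal solution of $\mathcal{UC}$ and $X^*=\mathbf{x}^*\mathbf{x}^{*\top}$; then $(\mathbf{x}^*,X^* )$ is optimal for $\mathcal{UC}^{\mathrm{CPP}}$. Let $(\lambda^*,\phi^*,\Lambda^*,\Phi^* )$ be (part of) an optimal solution of $\mathcal{UC}^{\mathrm{COP}}$. At hour $t$ the system operator collects from the load $$\pi^{\mathrm L}_t=\lambda_t^*d_t+\Lambda_t^*d_t^2+\sum_{j=1}^m\sum_{g\in\mathcal{G}}\left(b_{jgt}\phi^*_{jgt}+b_{jgt}^2\Phi^*_{jgt}\right)$$ and pays generator $g$ $$\pi^{\mathrm G}_{gt}=\lambda_t^*p^*_{gt}+\Lambda_t^*X^{pp*}_{gt,gt}+\sum_{j=1}^m\left(\phi^*_{jgt}\mathbf{a}_{jgt}^\top\mathbf{x}^*+\Phi^*_{jgt}\mathrm{Tr}(\mathbf{a}_{jgt}\mathbf{a}_{jgt}^\top X^* )\right)+\sum_{g'\in\mathcal{G}\setminus\{g\}}f_{gg't},$$ where the shares $f_{gg't}$ are any real numbers with $f_{gg't}+f_{g'gt}=2\Lambda_t^*X^{pp*}_{gt,g't}$ for $g\ne g'$, and $f_{gg't}=0$ whenever $X^{pp*}_{gt,g't}=0$. *)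

theory Defs
  imports "HOL-Analysis.Analysis"
begin

(* Generators, time periods and constraint labels j = 1..m are the elements of finite types
   'g, 't, 'j; the decision vector is indexed by the following type, so n = CARD of it. *)

datatype ('g, 't, 'j) uc_var =
    Startup 'g 't
  | OnOff 'g 't
  | Production 'g 't
  | Slack 'j 'g 't

lemma UNIV_uc_var:
  "(UNIV :: ('g, 't, 'j) uc_var set) =
     case_prod Startup ` UNIV \<union> case_prod OnOff ` UNIV \<union> case_prod Production ` UNIV \<union>
     (\<lambda>(j, g, t). Slack j g t) ` UNIV"
proof -
  have "v \<in> case_prod Startup ` UNIV \<union> case_prod OnOff ` UNIV \<union> case_prod Production ` UNIV \<union>
     (\<lambda>(j, g, t). Slack j g t) ` UNIV" for v :: "('g, 't, 'j) uc_var"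
    by (cases v) (auto simp: image_iff)
  then show ?thesis by blast
qed

instance uc_var :: (finite, finite, finite) finite
  by standard (simp add: UNIV_uc_var)

fun generator_of :: "('g, 't, 'j) uc_var \<Rightarrow> 'g" where
  "generator_of (Startup g t) = g"
| "generator_of (OnOff g t) = g"
| "generator_of (Production g t) = g"
| "generator_of (Slack j g t) = g"

definition nonneg_vec :: "real ^ 'n \<Rightarrow> bool" where
  "nonneg_vec x \<longleftrightarrow> (\<forall>i. 0 \<le> x $ i)"

definition symmetric :: "real ^ 'n ^ 'n \<Rightarrow> bool" where
  "symmetric X \<longleftrightarrow> transpose X = X"

definition outer :: "real ^ 'n \<Rightarrow> real ^ 'n \<Rightarrow> real ^ 'n ^ 'n" where
  "outer v w = (\<chi> i j. v $ i * w $ j)"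

definition copositive :: "(real ^ 'n ^ 'n) set" where
  "copositive = {X. symmetric X \<and> (\<forall>y. nonneg_vec y \<longrightarrow> 0 \<le> y \<bullet> (X *v y))}"

(* The factor has n rows and r columns with r arbitrary, so it is a function of the row index
   and of k < r; the right-hand side is the entrywise form of the factor times its transpose. *)
definition completely_positive :: "(real ^ 'n ^ 'n) set" where
  "completely_positive =
     {X. \<exists>(r::nat) (F :: 'n \<Rightarrow> nat \<Rightarrow> real).
           (\<forall>i. \<forall>k<r. 0 \<le> F i k) \<and> X = (\<chi> i j. \<Sum>k<r. F i k * F j k)}"

(* Order n + 1 is the index type 'n option; None is the first row and column. *)

definition bordered_vec :: "real \<Rightarrow> real ^ 'n \<Rightarrow> real ^ ('n option)" where
  "bordered_vec \<alpha> v = (\<chi> i. case i of None \<Rightarrow> \<alpha> | Some k \<Rightarrow> v $ k)"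

definition bordered_mat :: "real \<Rightarrow> real ^ 'n \<Rightarrow> real ^ 'n ^ 'n \<Rightarrow> real ^ ('n option) ^ ('n option)" where
  "bordered_mat \<alpha> v X =
     (\<chi> i j. case i of
         None \<Rightarrow> (case j of None \<Rightarrow> \<alpha> | Some l \<Rightarrow> v $ l)
       | Some k \<Rightarrow> (case j of None \<Rightarrow> v $ k | Some l \<Rightarrow> X $ k $ l))"

record ('g, 't, 'j) uc_data =
  prod_cost :: "'g \<Rightarrow> real"
  startup_cost :: "'g \<Rightarrow> real"
  demand :: "'t \<Rightarrow> real"
  lhs :: "'j \<Rightarrow> 'g \<Rightarrow> 't \<Rightarrow> real ^ ('g::finite, 't::finite, 'j::finite) uc_var"
  rhs :: "'j \<Rightarrow> 'g \<Rightarrow> 't \<Rightarrow> real"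

definition uc_cost ::
  "('g::finite, 't::finite, 'j::finite) uc_data \<Rightarrow> real ^ ('g, 't, 'j) uc_var \<Rightarrow> real" where
  "uc_cost D x =
     (\<Sum>g\<in>UNIV. \<Sum>t\<in>UNIV. prod_cost D g * x $ Production g t + startup_cost D g * x $ Startup g t)"

definition uc_linear_feasible ::
  "('g::finite, 't::finite, 'j::finite) uc_data \<Rightarrow> real ^ ('g, 't, 'j) uc_var \<Rightarrow> bool" where
  "uc_linear_feasible D x \<longleftrightarrow>
     (\<forall>t. (\<Sum>g\<in>UNIV. x $ Production g t) = demand D t) \<and>
     (\<forall>j g t. lhs D j g t \<bullet> x = rhs D j g t) \<and>
     nonneg_vec x"

definition uc_feasible ::
  "('g::finite, 't::finite, 'j::finite) uc_data \<Rightarrow> real ^ ('g, 't, 'j) uc_var \<Rightarrow> bool" where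
  "uc_feasible D x \<longleftrightarrow> uc_linear_feasible D x \<and> (\<forall>g t. x $ OnOff g t \<in> {0, 1})"

definition uc_wellformed :: "('g::finite, 't::finite, 'j::finite) uc_data \<Rightarrow> bool" where
  "uc_wellformed D \<longleftrightarrow>
     (\<forall>j g t v. generator_of v \<noteq> g \<longrightarrow> lhs D j g t $ v = 0) \<and>
     (\<forall>x. uc_linear_feasible D x \<longrightarrow> (\<forall>g t. 0 \<le> x $ OnOff g t \<and> x $ OnOff g t \<le> 1))"

definition cost_vec ::
  "('g::finite, 't::finite, 'j::finite) uc_data \<Rightarrow> real ^ ('g, 't, 'j) uc_var" where
  "cost_vec D =
     (\<chi> v. case v of Production g t \<Rightarrow> prod_cost D g | Startup g t \<Rightarrow> startup_cost D g
           | OnOff g t \<Rightarrow> 0 | Slack j g t \<Rightarrow> 0)"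

definition load_vec :: "'t \<Rightarrow> real ^ ('g::finite, 't::finite, 'j::finite) uc_var" where
  "load_vec t =
     (\<chi> v. case v of Production g s \<Rightarrow> (if s = t then 1 else 0) | Startup g s \<Rightarrow> 0
           | OnOff g s \<Rightarrow> 0 | Slack j g s \<Rightarrow> 0)"

lemma sum_uc_var:
  fixes F :: "('g::finite, 't::finite, 'j::finite) uc_var \<Rightarrow> real"
  shows "(\<Sum>v\<in>UNIV. F v) =
    (\<Sum>g\<in>UNIV. \<Sum>t\<in>UNIV. F (Startup g t)) + (\<Sum>g\<in>UNIV. \<Sum>t\<in>UNIV. F (OnOff g t)) +
    (\<Sum>g\<in>UNIV. \<Sum>t\<in>UNIV. F (Production g t)) + (\<Sum>j\<in>UNIV. \<Sum>g\<in>UNIV. \<Sum>t\<in>UNIV. F (Slack j g t))"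
proof -
  have pair: "(\<Sum>v\<in>case_prod C ` UNIV. F v) = (\<Sum>g\<in>UNIV. \<Sum>t\<in>UNIV. F (C g t))"
    if "inj (case_prod C)" for C :: "'g \<Rightarrow> 't \<Rightarrow> ('g, 't, 'j) uc_var"
    using that
    by (simp add: sum.reindex sum.cartesian_product case_prod_unfold flip: UNIV_Times_UNIV)
  have inj4: "inj (\<lambda>(j::'j, g::'g, t::'t). Slack j g t)"
    by (auto simp: inj_def)
  have slack: "(\<Sum>v\<in>(\<lambda>(j, g, t). Slack j g t) ` UNIV. F v) =
      (\<Sum>j\<in>UNIV. \<Sum>g\<in>UNIV. \<Sum>t\<in>UNIV. F (Slack j g t))"
    using inj4
    by (simp add: sum.reindex sum.cartesian_product case_prod_unfold flip: UNIV_Times_UNIV)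
  show ?thesis
    unfolding UNIV_uc_var
    by (subst sum.union_disjoint, simp, simp, fastforce)+
       (auto simp: slack pair inj_def)
qed

lemma cost_vec_inner: "cost_vec D \<bullet> x = uc_cost D x"
  by (simp add: inner_vec_def sum_uc_var cost_vec_def uc_cost_def sum.distrib)

lemma load_vec_inner: "load_vec t \<bullet> x = (\<Sum>g\<in>UNIV. x $ Production g t)"
  by (simp add: inner_vec_def sum_uc_var load_vec_def if_distrib[of "\<lambda>c. c * _"] cong: if_cong)

definition cpp_feasible ::
  "('g::finite, 't::finite, 'j::finite) uc_data \<Rightarrow>
   real ^ ('g, 't, 'j) uc_var \<Rightarrow> real ^ ('g, 't, 'j) uc_var ^ ('g, 't, 'j) uc_var \<Rightarrow> bool" where
  "cpp_feasible D x X \<longleftrightarrow>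
     symmetric X \<and>
     (\<forall>t. load_vec t \<bullet> x = demand D t) \<and>
     (\<forall>j g t. lhs D j g t \<bullet> x = rhs D j g t) \<and>
     (\<forall>t. trace (outer (load_vec t) (load_vec t) ** X) = (demand D t)\<^sup>2) \<and>
     (\<forall>j g t. trace (outer (lhs D j g t) (lhs D j g t) ** X) = (rhs D j g t)\<^sup>2) \<and>
     (\<forall>g t. x $ OnOff g t = X $ OnOff g t $ OnOff g t) \<and>
     bordered_mat 1 x X \<in> completely_positive"

definition cpp_value :: "('g::finite, 't::finite, 'j::finite) uc_data \<Rightarrow> ereal" where
  "cpp_value D = (INF (x, X) \<in> {(x, X). cpp_feasible D x X}. ereal (cost_vec D \<bullet> x))"

definition A_mat :: "real ^ 'n \<Rightarrow> real ^ ('n option) ^ ('n option)" where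
  "A_mat a = bordered_mat 0 ((1/2) *\<^sub>R a) 0"

definition A_tilde :: "real ^ 'n \<Rightarrow> real ^ ('n option) ^ ('n option)" where
  "A_tilde a = outer (bordered_vec 0 a) (bordered_vec 0 a)"

definition B_mat ::
  "'g \<Rightarrow> 't \<Rightarrow> real ^ (('g::finite, 't::finite, 'j::finite) uc_var option) ^ (('g, 't, 'j) uc_var option)" where
  "B_mat g t =
     (\<chi> i j. if (i = Some (OnOff g t) \<and> j = None) \<or> (i = None \<and> j = Some (OnOff g t)) then 1/2
            else if i = Some (OnOff g t) \<and> j = Some (OnOff g t) then - 1
            else 0)"

record ('g, 't, 'j) cop_var =
  lam :: "'t \<Rightarrow> real"
  phi :: "'j \<Rightarrow> 'g \<Rightarrow> 't \<Rightarrow> real"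
  Lam :: "'t \<Rightarrow> real"
  Phi :: "'j \<Rightarrow> 'g \<Rightarrow> 't \<Rightarrow> real"
  del :: "'g \<Rightarrow> 't \<Rightarrow> real"
  Omega :: "real ^ (('g::finite, 't::finite, 'j::finite) uc_var option) ^ (('g, 't, 'j) uc_var option)"

definition cop_objective ::
  "('g::finite, 't::finite, 'j::finite) uc_data \<Rightarrow> ('g, 't, 'j) cop_var \<Rightarrow> real" where
  "cop_objective D y =
     (\<Sum>t\<in>UNIV. demand D t * lam y t + (demand D t)\<^sup>2 * Lam y t +
        (\<Sum>j\<in>UNIV. \<Sum>g\<in>UNIV. rhs D j g t * phi y j g t + (rhs D j g t)\<^sup>2 * Phi y j g t))"

definition cop_feasible ::
  "('g::finite, 't::finite, 'j::finite) uc_data \<Rightarrow> ('g, 't, 'j) cop_var \<Rightarrow> bool" where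
  "cop_feasible D y \<longleftrightarrow>
     A_mat (cost_vec D)
       - (\<Sum>t\<in>UNIV. lam y t *\<^sub>R A_mat (load_vec t))
       - (\<Sum>j\<in>UNIV. \<Sum>g\<in>UNIV. \<Sum>t\<in>UNIV. phi y j g t *\<^sub>R A_mat (lhs D j g t))
       - (\<Sum>t\<in>UNIV. Lam y t *\<^sub>R A_tilde (load_vec t))
       - (\<Sum>j\<in>UNIV. \<Sum>g\<in>UNIV. \<Sum>t\<in>UNIV. Phi y j g t *\<^sub>R A_tilde (lhs D j g t))
       - (\<Sum>g\<in>UNIV. \<Sum>t\<in>UNIV. del y g t *\<^sub>R B_mat g t)
       - Omega y = 0 \<and>
     Omega y \<in> copositive"

definition cop_value :: "('g::finite, 't::finite, 'j::finite) uc_data \<Rightarrow> ereal" where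
  "cop_value D = (SUP y \<in> {y. cop_feasible D y}. ereal (cop_objective D y))"

definition load_payment ::
  "('g::finite, 't::finite, 'j::finite) uc_data \<Rightarrow> ('g, 't, 'j) cop_var \<Rightarrow> 't \<Rightarrow> real" where
  "load_payment D y t =
     lam y t * demand D t + Lam y t * (demand D t)\<^sup>2 +
     (\<Sum>j\<in>UNIV. \<Sum>g\<in>UNIV. rhs D j g t * phi y j g t + (rhs D j g t)\<^sup>2 * Phi y j g t)"

definition valid_shares ::
  "('g::finite, 't::finite, 'j::finite) cop_var \<Rightarrow>
   real ^ ('g, 't, 'j) uc_var ^ ('g, 't, 'j) uc_var \<Rightarrow> ('g \<Rightarrow> 'g \<Rightarrow> 't \<Rightarrow> real) \<Rightarrow> bool" where
  "valid_shares y X f \<longleftrightarrow>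
     (\<forall>g g' t. g \<noteq> g' \<longrightarrow>
        f g g' t + f g' g t = 2 * Lam y t * X $ Production g t $ Production g' t \<and>
        (X $ Production g t $ Production g' t = 0 \<longrightarrow> f g g' t = 0))"

definition generator_payment ::
  "('g::finite, 't::finite, 'j::finite) uc_data \<Rightarrow> ('g, 't, 'j) cop_var \<Rightarrow>
   real ^ ('g, 't, 'j) uc_var \<Rightarrow> real ^ ('g, 't, 'j) uc_var ^ ('g, 't, 'j) uc_var \<Rightarrow>
   ('g \<Rightarrow> 'g \<Rightarrow> 't \<Rightarrow> real) \<Rightarrow> 'g \<Rightarrow> 't \<Rightarrow> real" where
  "generator_payment D y x X f g t =
     lam y t * x $ Production g t + Lam y t * X $ Production g t $ Production g t +
     (\<Sum>j\<in>UNIV. phi y j g t * (lhs D j g t \<bullet> x) +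
                Phi y j g t * trace (outer (lhs D j g t) (lhs D j g t) ** X)) +
     (\<Sum>g'\<in>UNIV - {g}. f g g' t)"

end

theory Submission
  imports Defs
begin

text \<open>
  Both balances say that one number can be read in three ways: as the optimal cost of unit
  commitment, as the optimal value of the copositive dual, and as the total payment.

  The load payments sum to the dual objective by definition. The generator payments sum to it
  because the primal constraints hold at \<open>x\<close>: the production terms
  \<open>\<Lambda>\<^sub>t p\<^sub>g\<^sub>t\<^sup>2\<close> together with the shares, which distribute the cross terms
  \<open>2 \<Lambda>\<^sub>t p\<^sub>g\<^sub>t p\<^sub>g\<^sub>'\<^sub>t\<close> between the two generators concerned, recombine to
  \<open>\<Lambda>\<^sub>t (\<Sum>\<^sub>g p\<^sub>g\<^sub>t)\<^sup>2 = \<Lambda>\<^sub>t d\<^sub>t\<^sup>2\<close>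
  (lemma \<open>sum_generator_payment\<close>).

  What remains is that the dual optimum equals the cost of \<open>x\<close>. Strong duality
  identifies the dual optimum with the value of the completely positive problem, so this is
  Burer's theorem that the completely positive problem has the value of unit commitment
  (lemma \<open>cpp_value_eq_uc_cost\<close>). Its substance is that a completely positive feasible
  pair decomposes into columns \<open>(\<zeta>\<^sub>k, w\<^sub>k) \<ge> 0\<close> with \<open>\<Sum>\<^sub>k \<zeta>\<^sub>k\<^sup>2 = 1\<close> and vector part
  \<open>\<Sum>\<^sub>k \<zeta>\<^sub>k w\<^sub>k\<close>. The squared linear constraints are equality cases of the Cauchy-Schwarz
  inequality and force every column to satisfy the linear constraints with right-hand side
  scaled by \<open>\<zeta>\<^sub>k\<close>. As these constraints bound the on/off variables, each on/off entry of
  \<open>w\<^sub>k\<close> lies between \<open>0\<close> and \<open>\<zeta>\<^sub>k\<close>, and the diagonal constraint \<open>z = Z\<close> then forces it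
  to be one of the two endpoints. Hence the vector part is the convex combination, with
  weights \<open>\<zeta>\<^sub>k\<^sup>2\<close>, of the unit commitment schedules \<open>w\<^sub>k / \<zeta>\<^sub>k\<close> with \<open>\<zeta>\<^sub>k > 0\<close>, and costs at
  least as much as the best schedule.
\<close>

section \<open>Quadratic forms and completely positive factorizations\<close>

lemma trace_outer_mult:
  fixes a b :: "real ^ 'n"
  shows "trace (outer a b ** X) = b \<bullet> (X *v a)"
proof -
  have "trace (outer a b ** X) = (\<Sum>i\<in>UNIV. \<Sum>k\<in>UNIV. a $ i * b $ k * X $ k $ i)"
    by (simp add: trace_def matrix_matrix_mult_def outer_def)
  also have "\<dots> = (\<Sum>k\<in>UNIV. \<Sum>i\<in>UNIV. a $ i * b $ k * X $ k $ i)"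
    by (rule sum.swap)
  also have "\<dots> = b \<bullet> (X *v a)"
    by (simp add: inner_vec_def matrix_vector_mult_def sum_distrib_left mult_ac)
  finally show ?thesis .
qed

lemma outer_mult_vec: "outer v w *v a = (w \<bullet> a) *\<^sub>R v"
  by (simp add: vec_eq_iff outer_def matrix_vector_mult_def inner_vec_def sum_distrib_left mult_ac)

lemma trace_outer_mult_outer: "trace (outer a a ** outer x x) = (a \<bullet> x)\<^sup>2"
  by (simp add: trace_outer_mult outer_mult_vec power2_eq_square inner_commute)

lemma trace_outer_mult_sum_outer:
  "trace (outer a a ** (\<Sum>k\<in>K. outer (w k) (w k))) = (\<Sum>k\<in>K. (a \<bullet> w k)\<^sup>2)"
proof -
  have "(\<Sum>k\<in>K. outer (w k) (w k)) *v a = (\<Sum>k\<in>K. outer (w k) (w k) *v a)"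
    by (induction K rule: infinite_finite_induct) (simp_all add: matrix_vector_mult_add_rdistrib)
  then show ?thesis
    by (simp add: trace_outer_mult outer_mult_vec inner_sum_right power2_eq_square inner_commute)
qed

text \<open>
  The columns of a nonnegative factor of the bordered matrix, split into their entry in the
  bordering row and the remaining vector.
\<close>

lemma bordered_completely_positive_columns:
  assumes "bordered_mat 1 x X \<in> completely_positive"
  obtains r :: nat and \<zeta> w where
    "\<And>k. k < r \<Longrightarrow> 0 \<le> \<zeta> k" "\<And>k. k < r \<Longrightarrow> nonneg_vec (w k)"
    "(\<Sum>k<r. (\<zeta> k)\<^sup>2) = 1" "x = (\<Sum>k<r. \<zeta> k *\<^sub>R w k)" "X = (\<Sum>k<r. outer (w k) (w k))"
proof -
  obtain r :: nat and F where F: "\<And>i k. k < r \<Longrightarrow> 0 \<le> F i k"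
    and eq: "bordered_mat 1 x X = (\<chi> i j. \<Sum>k<r. F i k * F j k)"
    using assms unfolding completely_positive_def by blast
  have entry: "bordered_mat 1 x X $ i $ j = (\<Sum>k<r. F i k * F j k)" for i j
    by (simp add: eq)
  define \<zeta> where "\<zeta> = F None"
  define w where "w k = (\<chi> i. F (Some i) k)" for k
  show thesis
  proof (rule that[of r \<zeta> w])
    show "(\<Sum>k<r. (\<zeta> k)\<^sup>2) = 1"
      using entry[of None None] by (simp add: bordered_mat_def \<zeta>_def power2_eq_square)
    show "x = (\<Sum>k<r. \<zeta> k *\<^sub>R w k)"
      using entry[of None "Some _"] by (simp add: vec_eq_iff bordered_mat_def \<zeta>_def w_def)
    show "X = (\<Sum>k<r. outer (w k) (w k))"
      using entry[of "Some _" "Some _"] by (simp add: vec_eq_iff bordered_mat_def w_def outer_def)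
  qed (simp_all add: F \<zeta>_def w_def nonneg_vec_def)
qed

lemma bordered_outer_completely_positive:
  fixes x :: "real ^ 'n"
  assumes "nonneg_vec x"
  shows "bordered_mat 1 x (outer x x) \<in> completely_positive"
proof -
  define F :: "'n option \<Rightarrow> nat \<Rightarrow> real" where "F i k = bordered_vec 1 x $ i" for i k
  have "0 \<le> F i k" for i k
    using assms by (simp add: F_def bordered_vec_def nonneg_vec_def split: option.split)
  moreover have "bordered_mat 1 x (outer x x) = (\<chi> i j. \<Sum>k<Suc 0. F i k * F j k)"
    by (simp add: vec_eq_iff F_def bordered_mat_def bordered_vec_def outer_def split: option.split)
  ultimately show ?thesis
    unfolding completely_positive_def by blast
qed

text \<open>
  The hypotheses are the equality case of the Cauchy-Schwarz inequality for \<open>s\<close> and the unit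
  vector \<open>\<zeta>\<close>: the squared distance of \<open>s\<close> from \<open>b \<cdot> \<zeta>\<close> is \<open>b\<^sup>2 - 2 b\<^sup>2 + b\<^sup>2 = 0\<close>.
\<close>

lemma unit_Cauchy_Schwarz_equality:
  fixes \<zeta> s :: "'k \<Rightarrow> real"
  assumes "finite K" "(\<Sum>k\<in>K. (\<zeta> k)\<^sup>2) = 1" "(\<Sum>k\<in>K. \<zeta> k * s k) = b" "(\<Sum>k\<in>K. (s k)\<^sup>2) = b\<^sup>2"
    and "k \<in> K"
  shows "s k = b * \<zeta> k"
proof -
  have "(\<Sum>k\<in>K. (s k - b * \<zeta> k)\<^sup>2)
      = (\<Sum>k\<in>K. (s k)\<^sup>2) - 2 * b * (\<Sum>k\<in>K. \<zeta> k * s k) + b\<^sup>2 * (\<Sum>k\<in>K. (\<zeta> k)\<^sup>2)"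
    by (simp add: power2_diff power_mult_distrib sum.distrib sum_subtractf sum_distrib_left mult_ac)
  also have "\<dots> = 0"
    using assms by (simp add: power2_eq_square)
  finally have "\<forall>k\<in>K. (s k - b * \<zeta> k)\<^sup>2 = 0"
    using assms(1) by (subst (asm) sum_nonneg_eq_0_iff) auto
  with assms(5) show ?thesis by simp
qed

section \<open>The value of the completely positive reformulation\<close>

lemma uc_linear_feasible_iff:
  "uc_linear_feasible D x \<longleftrightarrow>
     (\<forall>t. load_vec t \<bullet> x = demand D t) \<and> (\<forall>j g t. lhs D j g t \<bullet> x = rhs D j g t) \<and> nonneg_vec x"
  by (simp add: uc_linear_feasible_def load_vec_inner)

lemma uc_feasible_imp_cpp_feasible:
  assumes "uc_feasible D x"
  shows "cpp_feasible D x (outer x x)"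
proof -
  have lin: "uc_linear_feasible D x" and bin: "x $ OnOff g t \<in> {0, 1}" for g t
    using assms by (simp_all add: uc_feasible_def)
  have "x $ OnOff g t = outer x x $ OnOff g t $ OnOff g t" for g t
    using bin[of g t] by (auto simp: outer_def)
  moreover have "symmetric (outer x x)"
    by (simp add: symmetric_def transpose_def outer_def vec_eq_iff mult.commute)
  ultimately show ?thesis
    using lin bordered_outer_completely_positive[of x]
    unfolding cpp_feasible_def uc_linear_feasible_iff trace_outer_mult_outer by simp
qed

text \<open>
  Up to scaling, a nonnegative column satisfying the homogenized linear constraints is a
  linearly feasible point if \<open>\<zeta> > 0\<close> and a recession direction if \<open>\<zeta> = 0\<close>. The on/off
  entries are bounded on the linearly feasible region, so they vanish along recession directions
  and the bound below covers both cases. A recession direction only yields information when the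
  region is nonempty; hence the base point \<open>x\<close>.
\<close>

lemma homogenized_onoff_bounds:
  assumes wf: "uc_wellformed D" and x: "uc_linear_feasible D x"
    and "0 \<le> \<zeta>" and w: "nonneg_vec w"
    and load: "\<And>t. load_vec t \<bullet> w = demand D t * \<zeta>"
    and oper: "\<And>j g t. lhs D j g t \<bullet> w = rhs D j g t * \<zeta>"
  shows "0 \<le> w $ OnOff g t \<and> w $ OnOff g t \<le> \<zeta>"
proof (cases "\<zeta> = 0")
  case True
  have ray: "uc_linear_feasible D (x + s *\<^sub>R w)" if "0 \<le> s" for s
    using x w load oper that True
    by (simp add: uc_linear_feasible_iff inner_add_right nonneg_vec_def)
  have bound: "s * w $ OnOff g t \<le> 1" if "0 \<le> s" for s
  proof -
    have "x $ OnOff g t + s * w $ OnOff g t \<le> 1"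
      using wf ray[OF that] unfolding uc_wellformed_def by fastforce
    moreover have "0 \<le> x $ OnOff g t"
      using x by (simp add: uc_linear_feasible_iff nonneg_vec_def)
    ultimately show ?thesis by linarith
  qed
  have nonneg: "0 \<le> w $ OnOff g t"
    using w by (simp add: nonneg_vec_def)
  have "\<not> 0 < w $ OnOff g t"
    using bound[of "2 / w $ OnOff g t"] by auto
  with nonneg True show ?thesis by linarith
next
  case False
  with \<open>0 \<le> \<zeta>\<close> have "0 < \<zeta>" by simp
  have "uc_linear_feasible D ((1 / \<zeta>) *\<^sub>R w)"
    using w load oper \<open>0 < \<zeta>\<close> by (simp add: uc_linear_feasible_iff nonneg_vec_def)
  then have "0 \<le> w $ OnOff g t / \<zeta> \<and> w $ OnOff g t / \<zeta> \<le> 1"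
    using wf unfolding uc_wellformed_def by fastforce
  then show ?thesis
    using \<open>0 < \<zeta>\<close> by (simp add: divide_le_eq zero_le_divide_iff)
qed

text \<open>
  The core of Burer's theorem. Columns with \<open>\<zeta> k = 0\<close> do not contribute to the vector part
  \<open>x' = (\<Sum>k<r. \<zeta> k *\<^sub>R w k)\<close>, so only the columns that rescale to schedules affect the cost.
\<close>

lemma cpp_feasible_convex_combination:
  fixes D :: "('g::finite, 't::finite, 'j::finite) uc_data"
  assumes wf: "uc_wellformed D" and lin: "uc_linear_feasible D x" and cpp: "cpp_feasible D x' X"
  obtains r :: nat and \<zeta> w where
    "\<And>k. k < r \<Longrightarrow> 0 < \<zeta> k \<Longrightarrow> uc_feasible D ((1 / \<zeta> k) *\<^sub>R w k)"
    "\<And>k. k < r \<Longrightarrow> 0 \<le> \<zeta> k" "(\<Sum>k<r. (\<zeta> k)\<^sup>2) = 1" "x' = (\<Sum>k<r. \<zeta> k *\<^sub>R w k)"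
proof -
  have "bordered_mat 1 x' X \<in> completely_positive"
    using cpp by (simp add: cpp_feasible_def)
  then obtain r :: nat and \<zeta> w where \<zeta>: "\<And>k. k < r \<Longrightarrow> 0 \<le> \<zeta> k"
    and w: "\<And>k. k < r \<Longrightarrow> nonneg_vec (w k)" and unit: "(\<Sum>k<r. (\<zeta> k)\<^sup>2) = 1"
    and x': "x' = (\<Sum>k<r. \<zeta> k *\<^sub>R w k)" and X: "X = (\<Sum>k<r. outer (w k) (w k))"
    by (rule bordered_completely_positive_columns) blast
  have homogenize: "a \<bullet> w k = b * \<zeta> k"
    if "a \<bullet> x' = b" "trace (outer a a ** X) = b\<^sup>2" "k < r" for a b k
  proof (rule unit_Cauchy_Schwarz_equality[of "{..<r}"])
    show "(\<Sum>k<r. \<zeta> k * (a \<bullet> w k)) = b"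
      using that(1) by (simp add: x' inner_sum_right)
    show "(\<Sum>k<r. (a \<bullet> w k)\<^sup>2) = b\<^sup>2"
      using that(2) by (simp add: X trace_outer_mult_sum_outer)
  qed (use that unit in auto)
  have load: "load_vec t \<bullet> w k = demand D t * \<zeta> k" if "k < r" for k t
    using cpp that by (intro homogenize) (simp_all add: cpp_feasible_def)
  have oper: "lhs D j g t \<bullet> w k = rhs D j g t * \<zeta> k" if "k < r" for k j g t
    using cpp that by (intro homogenize) (simp_all add: cpp_feasible_def)
  have onoff: "w k $ OnOff g t = 0 \<or> w k $ OnOff g t = \<zeta> k" if "k < r" for k g t
  proof -
    have bounds: "0 \<le> w k $ OnOff g t \<and> w k $ OnOff g t \<le> \<zeta> k" if "k < r" for k
      using homogenized_onoff_bounds[OF wf lin \<zeta> w load oper] that by blast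
    \<comment> \<open>The diagonal constraint \<open>z = Z\<close> says that these nonnegative products sum to zero.\<close>
    have "(\<Sum>k<r. \<zeta> k * w k $ OnOff g t) = (\<Sum>k<r. w k $ OnOff g t * w k $ OnOff g t)"
      using cpp by (simp add: cpp_feasible_def x' X outer_def)
    then have "(\<Sum>k<r. w k $ OnOff g t * (\<zeta> k - w k $ OnOff g t)) = 0"
      by (simp add: algebra_simps sum_subtractf)
    then have "\<forall>k\<in>{..<r}. w k $ OnOff g t * (\<zeta> k - w k $ OnOff g t) = 0"
      using bounds by (subst (asm) sum_nonneg_eq_0_iff) auto
    with that show ?thesis by auto
  qed
  have "uc_feasible D ((1 / \<zeta> k) *\<^sub>R w k)" if "k < r" "0 < \<zeta> k" for k
  proof -
    have "uc_linear_feasible D ((1 / \<zeta> k) *\<^sub>R w k)"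
      using load[OF that(1)] oper[OF that(1)] w[OF that(1)] that(2)
      by (simp add: uc_linear_feasible_iff nonneg_vec_def)
    moreover have "((1 / \<zeta> k) *\<^sub>R w k) $ OnOff g t \<in> {0, 1}" for g t
      using onoff[OF that(1), of g t] that(2) by auto
    ultimately show ?thesis by (simp add: uc_feasible_def)
  qed
  then show thesis
    using that \<zeta> unit x' by blast
qed

lemma uc_cost_scaleR: "uc_cost D (s *\<^sub>R x) = s * uc_cost D x"
  by (simp flip: cost_vec_inner)

lemma cpp_feasible_cost_ge:
  assumes wf: "uc_wellformed D" and opt: "is_arg_min (uc_cost D) (uc_feasible D) x"
    and cpp: "cpp_feasible D x' X"
  shows "uc_cost D x \<le> uc_cost D x'"
proof -
  have lin: "uc_linear_feasible D x"
    using opt by (simp add: is_arg_min_def uc_feasible_def)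
  obtain r :: nat and \<zeta> w
    where schedule: "\<And>k. k < r \<Longrightarrow> 0 < \<zeta> k \<Longrightarrow> uc_feasible D ((1 / \<zeta> k) *\<^sub>R w k)"
    and \<zeta>: "\<And>k. k < r \<Longrightarrow> 0 \<le> \<zeta> k" and unit: "(\<Sum>k<r. (\<zeta> k)\<^sup>2) = 1"
    and x': "x' = (\<Sum>k<r. \<zeta> k *\<^sub>R w k)"
    using cpp_feasible_convex_combination[OF wf lin cpp] by blast
  have column: "(\<zeta> k)\<^sup>2 * uc_cost D x \<le> \<zeta> k * uc_cost D (w k)" if "k < r" for k
  proof (cases "\<zeta> k = 0")
    case False
    with \<zeta> that have pos: "0 < \<zeta> k" by (simp add: order_less_le)
    have "uc_cost D x \<le> uc_cost D ((1 / \<zeta> k) *\<^sub>R w k)"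
      using opt schedule[OF that pos] by (auto simp: is_arg_min_def not_less)
    then have "uc_cost D x * \<zeta> k \<le> uc_cost D (w k)"
      using pos by (simp add: uc_cost_scaleR pos_le_divide_eq)
    then have "\<zeta> k * (uc_cost D x * \<zeta> k) \<le> \<zeta> k * uc_cost D (w k)"
      using pos by simp
    then show ?thesis by (simp add: power2_eq_square mult_ac)
  qed simp
  have "uc_cost D x = (\<Sum>k<r. (\<zeta> k)\<^sup>2 * uc_cost D x)"
    by (simp add: unit flip: sum_distrib_right)
  also have "\<dots> \<le> (\<Sum>k<r. \<zeta> k * uc_cost D (w k))"
    by (intro sum_mono column) simp
  also have "\<dots> = uc_cost D x'"
    by (simp add: x' inner_sum_right flip: cost_vec_inner)
  finally show ?thesis .
qed

lemma cpp_value_eq_uc_cost: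
  assumes wf: "uc_wellformed D" and opt: "is_arg_min (uc_cost D) (uc_feasible D) x"
  shows "cpp_value D = ereal (uc_cost D x)"
proof (rule antisym)
  have "cpp_feasible D x (outer x x)"
    using opt by (intro uc_feasible_imp_cpp_feasible) (simp add: is_arg_min_def)
  then show "cpp_value D \<le> ereal (uc_cost D x)"
    unfolding cpp_value_def cost_vec_inner
    by (intro INF_lower2[of "(x, outer x x)"]) auto
  show "ereal (uc_cost D x) \<le> cpp_value D"
    unfolding cpp_value_def cost_vec_inner
    using cpp_feasible_cost_ge[OF wf opt] by (intro INF_greatest) auto
qed

lemma cop_value_eq_objective:
  assumes "is_arg_max (cop_objective D) (cop_feasible D) y"
  shows "cop_value D = ereal (cop_objective D y)"
proof (rule antisym)
  show "cop_value D \<le> ereal (cop_objective D y)"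
    unfolding cop_value_def
    using assms by (intro SUP_least) (auto simp: is_arg_max_def not_less)
  show "ereal (cop_objective D y) \<le> cop_value D"
    unfolding cop_value_def
    using assms by (intro SUP_upper) (auto simp: is_arg_max_def)
qed

section \<open>Total payments\<close>

lemma sum_load_payment: "(\<Sum>t\<in>UNIV. load_payment D y t) = cop_objective D y"
  by (simp add: load_payment_def cop_objective_def mult.commute)

text \<open>
  A sum over ordered pairs meets each unordered pair as \<open>f g g' + f g' g\<close>, so only the total
  \<open>2 c (p g) (p g')\<close> of the two shares matters, and that is the cross term in the expansion of
  the square.
\<close>

lemma squares_plus_shares_eq_square_sum:
  fixes p :: "'g::finite \<Rightarrow> real"
  assumes "\<And>g g'. g \<noteq> g' \<Longrightarrow> f g g' + f g' g = 2 * c * (p g * p g')"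
  shows "(\<Sum>g\<in>UNIV. c * (p g)\<^sup>2 + (\<Sum>g'\<in>UNIV - {g}. f g g')) = c * (\<Sum>g\<in>UNIV. p g)\<^sup>2"
proof -
  \<comment> \<open>With the square as diagonal entry, the share relation holds without exception.\<close>
  define h where "h g g' = (if g = g' then c * (p g)\<^sup>2 else f g g')" for g g'
  have h: "h g g' + h g' g = 2 * c * (p g * p g')" for g g'
    using assms by (simp add: h_def power2_eq_square)
  have "c * (p g)\<^sup>2 + (\<Sum>g'\<in>UNIV - {g}. f g g') = (\<Sum>g'\<in>UNIV. h g g')" for g
    by (subst sum.remove[of _ g]) (auto simp: h_def intro!: sum.cong)
  then have "(\<Sum>g\<in>UNIV. c * (p g)\<^sup>2 + (\<Sum>g'\<in>UNIV - {g}. f g g')) = (\<Sum>g\<in>UNIV. \<Sum>g'\<in>UNIV. h g g')"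
    by simp
  moreover have "2 * (\<Sum>g\<in>UNIV. \<Sum>g'\<in>UNIV. h g g')
      = (\<Sum>g\<in>UNIV. \<Sum>g'\<in>UNIV. h g g') + (\<Sum>g\<in>UNIV. \<Sum>g'\<in>UNIV. h g' g)"
    by (subst (3) sum.swap) simp
  moreover have "\<dots> = (\<Sum>g\<in>UNIV. \<Sum>g'\<in>UNIV. 2 * c * (p g * p g'))"
    by (simp add: h flip: sum.distrib)
  moreover have "\<dots> = 2 * c * (\<Sum>g\<in>UNIV. p g)\<^sup>2"
    by (simp add: power2_eq_square sum_product flip: sum_distrib_left)
  ultimately show ?thesis by simp
qed

lemma sum_generator_payment:
  fixes D :: "('g::finite, 't::finite, 'j::finite) uc_data"
  assumes lin: "uc_linear_feasible D x" and shares: "valid_shares y (outer x x) f"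
  shows "(\<Sum>g\<in>UNIV. \<Sum>t\<in>UNIV. generator_payment D y x (outer x x) f g t) = cop_objective D y"
proof -
  define q where "q t = (\<Sum>j\<in>UNIV. \<Sum>g\<in>UNIV. rhs D j g t * phi y j g t + (rhs D j g t)\<^sup>2 * Phi y j g t)"
    for t
  have demand: "(\<Sum>g\<in>UNIV. x $ Production g t) = demand D t" for t
    using lin by (simp add: uc_linear_feasible_def)
  have oper: "lhs D j g t \<bullet> x = rhs D j g t" for j g t
    using lin by (simp add: uc_linear_feasible_def)
  have own: "outer x x $ Production g t $ Production g t = (x $ Production g t)\<^sup>2" for g t
    by (simp add: outer_def power2_eq_square)
  have period: "(\<Sum>g\<in>UNIV. generator_payment D y x (outer x x) f g t)
      = demand D t * lam y t + (demand D t)\<^sup>2 * Lam y t + q t" for t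
  proof -
    have "(\<Sum>g\<in>UNIV. generator_payment D y x (outer x x) f g t)
      = (\<Sum>g\<in>UNIV. lam y t * x $ Production g t)
        + (\<Sum>g\<in>UNIV. Lam y t * (x $ Production g t)\<^sup>2 + (\<Sum>g'\<in>UNIV - {g}. f g g' t))
        + (\<Sum>g\<in>UNIV. \<Sum>j\<in>UNIV. rhs D j g t * phi y j g t + (rhs D j g t)\<^sup>2 * Phi y j g t)"
      by (simp add: generator_payment_def trace_outer_mult_outer oper own
          mult_ac add_ac flip: sum.distrib)
    also have "(\<Sum>g\<in>UNIV. lam y t * x $ Production g t) = demand D t * lam y t"
      by (simp add: demand mult.commute flip: sum_distrib_left)
    also have "(\<Sum>g\<in>UNIV. Lam y t * (x $ Production g t)\<^sup>2 + (\<Sum>g'\<in>UNIV - {g}. f g g' t))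
        = Lam y t * (\<Sum>g\<in>UNIV. x $ Production g t)\<^sup>2"
      using shares
      by (intro squares_plus_shares_eq_square_sum) (simp add: valid_shares_def outer_def)
    also have "(\<Sum>g\<in>UNIV. \<Sum>j\<in>UNIV. rhs D j g t * phi y j g t + (rhs D j g t)\<^sup>2 * Phi y j g t) = q t"
      unfolding q_def by (rule sum.swap)
    finally show ?thesis by (simp add: demand mult.commute)
  qed
  have "(\<Sum>g\<in>UNIV. \<Sum>t\<in>UNIV. generator_payment D y x (outer x x) f g t)
      = (\<Sum>t\<in>UNIV. \<Sum>g\<in>UNIV. generator_payment D y x (outer x x) f g t)"
    by (rule sum.swap)
  then show ?thesis
    by (simp add: period cop_objective_def q_def)
qed

theorem theorem1:
  fixes D :: "('g::finite, 't::finite, 'j::finite) uc_data"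
    and x :: "real ^ ('g, 't, 'j) uc_var"
    and y :: "('g, 't, 'j) cop_var"
    and f :: "'g \<Rightarrow> 'g \<Rightarrow> 't \<Rightarrow> real"
  assumes "uc_wellformed D"
    and "is_arg_min (uc_cost D) (uc_feasible D) x"
    and "cpp_value D = cop_value D"
    and "is_arg_max (cop_objective D) (cop_feasible D) y"
    and "valid_shares y (outer x x) f"
  shows "(\<Sum>g\<in>UNIV. \<Sum>t\<in>UNIV. generator_payment D y x (outer x x) f g t) =
           (\<Sum>g\<in>UNIV. \<Sum>t\<in>UNIV.
              prod_cost D g * x $ Production g t + startup_cost D g * x $ Startup g t) \<and>
         (\<Sum>t\<in>UNIV. load_payment D y t) =
           (\<Sum>g\<in>UNIV. \<Sum>t\<in>UNIV. generator_payment D y x (outer x x) f g t)"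
proof -
  have "ereal (uc_cost D x) = ereal (cop_objective D y)"
    using cpp_value_eq_uc_cost[OF assms(1,2)] assms(3) cop_value_eq_objective[OF assms(4)] by simp
  then have "uc_cost D x = cop_objective D y" by simp
  moreover have "uc_linear_feasible D x"
    using assms(2) by (simp add: is_arg_min_def uc_feasible_def)
  ultimately show ?thesis
    using assms(5) by (simp add: sum_generator_payment sum_load_payment uc_cost_def)
qed

end
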